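(* Let $M_G$ be a mixed graph on $n$ vertices whose underlying graph $G$ is simple, finite and connected. Then $M_G$ has property $SP$ if and only if its Hermitian Laplacian matrix of the second kind $L(M_G)$ is singular.
   Context: A mixed graph $M_G$ is obtained from $G$ by giving directions to some of its edges. Let $\omega=\frac{1+\sqrt{3}\mathbf{i}}{2}$. $N(M_G)=(n_{ij})$ has $n_{ij}=1$ if $v_i,v_j$ are joined by an undirected edge, $n_{ij}=\omega$ if there is an edge directed $v_i\to v_j$, $n_{ij}=\overline{\omega}$ if directed $v_j\to v_i$, and $0$ otherwise; $L(M_G)=D(M_G)-N(M_G)$, with $D(M_G)$ the degree diagonal matrix of $G$. $M_G$ has property $SP$ if its vertex set can be partitioned into six (possibly empty) parts $V_1,\dots,V_6$ such that every undirected edge has both endpoints in the same part, and every directed edge goes from a vertex of $V_i$ to a vertex of $V_{i+1}$ for some $i\in\{1,\dots,5\}$, or from a vertex of $V_6$ to a vertex of $V_1$. *)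

theory Defs
  imports "HOL-Analysis.Analysis" "HOL-Library.Disjoint_Sets"
begin

text \<open>
  A graph on n vertices has the elements of a finite type as its vertices, so its matrices are
  square matrices indexed by that type. A simple graph is a set \<open>E\<close> of two-element sets of vertices.
\<close>

definition simple_graph :: "'v::finite set set \<Rightarrow> bool" where
  "simple_graph E \<longleftrightarrow> (\<forall>e\<in>E. card e = 2)"

definition adj_rel :: "'v::finite set set \<Rightarrow> ('v \<times> 'v) set" where
  "adj_rel E = {(u, v). {u, v} \<in> E}"

definition connected_graph :: "'v::finite set set \<Rightarrow> bool" where
  "connected_graph E \<longleftrightarrow> (\<forall>u v. (u, v) \<in> (adj_rel E)\<^sup>*)"

definition vertex_degree :: "'v::finite set set \<Rightarrow> 'v \<Rightarrow> nat" where
  "vertex_degree E v = card {e \<in> E. v \<in> e}"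

text \<open>
  \<open>A\<close> is the set of directed edges of a mixed graph with underlying graph \<open>E\<close>: \<open>(u, v) \<in> A\<close> means
  that the edge \<open>{u, v}\<close> has been directed from \<open>u\<close> to \<open>v\<close>.
\<close>

definition mixed_graph :: "'v::finite set set \<Rightarrow> ('v \<times> 'v) set \<Rightarrow> bool" where
  "mixed_graph E A \<longleftrightarrow> simple_graph E \<and>
     (\<forall>u v. (u, v) \<in> A \<longrightarrow> {u, v} \<in> E \<and> (v, u) \<notin> A)"

definition undirected_edge :: "'v::finite set set \<Rightarrow> ('v \<times> 'v) set \<Rightarrow> 'v \<Rightarrow> 'v \<Rightarrow> bool" where
  "undirected_edge E A u v \<longleftrightarrow> {u, v} \<in> E \<and> (u, v) \<notin> A \<and> (v, u) \<notin> A"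

definition omega :: complex where
  "omega = (1 + complex_of_real (sqrt 3) * \<i>) / 2"

definition hermitian_adjacency2 :: "'v::finite set set \<Rightarrow> ('v \<times> 'v) set \<Rightarrow> complex ^ 'v ^ 'v" where
  "hermitian_adjacency2 E A = (\<chi> u v.
     if undirected_edge E A u v then 1
     else if (u, v) \<in> A then omega
     else if (v, u) \<in> A then cnj omega
     else 0)"

definition degree_matrix :: "'v::finite set set \<Rightarrow> complex ^ 'v ^ 'v" where
  "degree_matrix E = (\<chi> u v. if u = v then of_nat (vertex_degree E u) else 0)"

definition hermitian_laplacian2 :: "'v::finite set set \<Rightarrow> ('v \<times> 'v) set \<Rightarrow> complex ^ 'v ^ 'v" where
  "hermitian_laplacian2 E A = degree_matrix E - hermitian_adjacency2 E A"

definition property_SP :: "'v::finite set set \<Rightarrow> ('v \<times> 'v) set \<Rightarrow> bool" where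
  "property_SP E A \<longleftrightarrow> (\<exists>V :: nat \<Rightarrow> 'v set.
     (\<Union>i\<in>{1..6}. V i) = UNIV \<and> disjoint_family_on V {1..6} \<and>
     (\<forall>u v. undirected_edge E A u v \<longrightarrow> (\<exists>i\<in>{1..6}. u \<in> V i \<and> v \<in> V i)) \<and>
     (\<forall>u v. (u, v) \<in> A \<longrightarrow>
        (\<exists>i\<in>{1..5}. u \<in> V i \<and> v \<in> V (i + 1)) \<or> (u \<in> V 6 \<and> v \<in> V 1)))"

end

theory Submission imports Defs begin

text \<open>
  For every vertex u the u-th entry of \<open>L x\<close> is the sum of \<open>x\<^sub>u - n\<^sub>u\<^sub>v x\<^sub>v\<close> over the neighbours v of u.
  A partition as in property SP gives the kernel vector with value \<open>\<omega>\<close> to the power \<open>-i\<close> on \<open>V\<^sub>i\<close>, for which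
  every summand vanishes. Conversely, let x be a nonzero kernel vector and u a vertex at which
  \<open>|x\<^sub>u|\<close> is maximal. Then \<open>x\<^sub>u\<close> is the average of the numbers \<open>n\<^sub>u\<^sub>v x\<^sub>v\<close>, whose moduli are at most \<open>|x\<^sub>u|\<close>,
  so all of them equal \<open>x\<^sub>u\<close>. In particular the maximum is also attained at the neighbours of u, hence
  by connectedness everywhere, and \<open>x\<^sub>u = n\<^sub>u\<^sub>v x\<^sub>v\<close> holds along all edges. So all entries of x differ
  from a fixed one by a power of \<open>\<omega>\<close>, and the six possible values define the parts.
\<close>

section \<open>Powers of the sixth root of unity\<close>

lemma omega_mult_cnj: "omega * cnj omega = 1"
  by (simp add: omega_def complex_eq_iff power2_eq_square field_simps)

lemma norm_omega: "norm omega = 1"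
proof -
  have "(norm omega)\<^sup>2 = 1"
    using omega_mult_cnj complex_norm_square[of omega] by (metis of_real_eq_1_iff)
  thus ?thesis
    by (metis norm_ge_zero power2_eq_1_iff le_minus_one_simps(3))
qed

text \<open>All follow from the quadratic equation for \<open>cnj omega\<close>: one more
  multiplication gives the cube -1, and the rest are products with the cube.\<close>

lemma cnj_omega_powers:
  "cnj omega ^ 2 = cnj omega - 1" "cnj omega ^ 3 = - 1" "cnj omega ^ 4 = - cnj omega"
  "cnj omega ^ 5 = 1 - cnj omega" "cnj omega ^ 6 = 1"
proof -
  show 2: "cnj omega ^ 2 = cnj omega - 1"
    by (simp add: omega_def complex_eq_iff power2_eq_square field_simps)
  show 3: "cnj omega ^ 3 = - 1"
  proof -
    have "cnj omega ^ 3 = cnj omega * cnj omega ^ 2"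
      by (simp flip: power_Suc)
    also have "\<dots> = cnj omega * (cnj omega - 1)"
      by (simp only: 2)
    also have "\<dots> = cnj omega ^ 2 - cnj omega"
      by (simp add: power2_eq_square right_diff_distrib)
    finally show ?thesis
      by (simp add: 2)
  qed
  have "cnj omega ^ 4 = cnj omega ^ 3 * cnj omega" "cnj omega ^ 5 = cnj omega ^ 3 * cnj omega ^ 2"
    "cnj omega ^ 6 = cnj omega ^ 3 * cnj omega ^ 3"
    by (simp_all flip: power_add power_Suc2)
  thus "cnj omega ^ 4 = - cnj omega" "cnj omega ^ 5 = 1 - cnj omega" "cnj omega ^ 6 = 1"
    by (simp_all add: 2 3)
qed

text \<open>In the linear form of \<open>cnj_omega_powers\<close>, only the third of these powers is
  real, and it is -1.\<close>

lemma cnj_omega_power_neq_1: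
  assumes "0 < d" "d < 6"
  shows "cnj omega ^ d \<noteq> 1"
proof -
  have "Im (cnj omega) \<noteq> 0"
    by (simp add: omega_def)
  hence "cnj omega \<noteq> 1" "cnj omega - 1 \<noteq> 1" "- cnj omega \<noteq> 1" "1 - cnj omega \<noteq> 1"
    by (auto simp: complex_eq_iff)
  moreover have "d \<in> {1, 2, 3, 4, 5}"
    using assms by auto
  ultimately show ?thesis
    by (auto simp: cnj_omega_powers)
qed

lemma inj_on_cnj_omega_power: "inj_on (\<lambda>i. cnj omega ^ i) {1..6}"
proof (rule linorder_inj_onI)
  fix i j :: nat
  assume ij: "i < j" "i \<in> {1..6}" "j \<in> {1..6}"
  have "cnj omega ^ j = cnj omega ^ i * cnj omega ^ (j - i)"
    using ij by (simp flip: power_add)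
  moreover have "cnj omega ^ (j - i) \<noteq> 1"
    using ij by (intro cnj_omega_power_neq_1) auto
  moreover have "cnj omega \<noteq> 0"
    using omega_mult_cnj by auto
  ultimately show "cnj omega ^ i \<noteq> cnj omega ^ j"
    by simp
qed auto

text \<open>The exponents count modulo 6 with representatives 1 to 6, so the successor of 6 is
  1.\<close>

lemma cnj_omega_power_shift:
  assumes "i \<in> {1..6}"
  obtains j where "j \<in> {1..6}" "cnj omega ^ j = cnj omega * cnj omega ^ i"
proof (cases "i = 6")
  case True
  thus ?thesis
    using that[of 1] by (simp add: cnj_omega_powers)
next
  case False
  thus ?thesis
    using that[of "Suc i"] assms by simp
qed

lemma omega_mult_cnj_power: "omega * cnj omega ^ Suc i = cnj omega ^ i"
  using omega_mult_cnj by (simp add: mult.assoc[symmetric])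

section \<open>The Laplacian as a sum over neighbours\<close>

lemma vertex_degree_eq_card_neighbours:
  assumes "simple_graph E"
  shows "vertex_degree E u = card {v. {u, v} \<in> E}"
proof -
  have "bij_betw (\<lambda>v. {u, v}) {v. {u, v} \<in> E} {e \<in> E. u \<in> e}"
  proof (rule bij_betwI')
    fix e assume e: "e \<in> {e \<in> E. u \<in> e}"
    then obtain a b where "e = {a, b}"
      using assms by (auto simp: simple_graph_def card_2_iff)
    thus "\<exists>v\<in>{v. {u, v} \<in> E}. e = {u, v}"
      using e by (auto simp: insert_commute)
  qed (auto simp: doubleton_eq_iff)
  thus ?thesis
    by (simp add: vertex_degree_def bij_betw_same_card)
qed

text \<open>The cases cannot clash: a directed edge lies over an edge of \<open>E\<close> and is
  never directed both ways.\<close>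

lemma hermitian_adjacency2_simps:
  assumes "mixed_graph E A"
  shows "undirected_edge E A u v \<Longrightarrow> hermitian_adjacency2 E A $ u $ v = 1"
    and "(u, v) \<in> A \<Longrightarrow> hermitian_adjacency2 E A $ u $ v = omega"
    and "(v, u) \<in> A \<Longrightarrow> hermitian_adjacency2 E A $ u $ v = cnj omega"
    and "{u, v} \<notin> E \<Longrightarrow> hermitian_adjacency2 E A $ u $ v = 0"
proof -
  have "{u, v} \<in> E" if "(u, v) \<in> A \<or> (v, u) \<in> A"
    using that assms unfolding mixed_graph_def by (metis insert_commute)
  thus "undirected_edge E A u v \<Longrightarrow> hermitian_adjacency2 E A $ u $ v = 1"
    and "(u, v) \<in> A \<Longrightarrow> hermitian_adjacency2 E A $ u $ v = omega"
    and "(v, u) \<in> A \<Longrightarrow> hermitian_adjacency2 E A $ u $ v = cnj omega"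
    and "{u, v} \<notin> E \<Longrightarrow> hermitian_adjacency2 E A $ u $ v = 0"
    using assms by (auto simp: hermitian_adjacency2_def undirected_edge_def mixed_graph_def)
qed

lemma mixed_graph_edge_cases:
  assumes "{u, v} \<in> E"
  obtains "undirected_edge E A u v" | "(u, v) \<in> A" | "(v, u) \<in> A"
  using assms by (auto simp: undirected_edge_def)

lemma norm_hermitian_adjacency2:
  assumes "mixed_graph E A" "{u, v} \<in> E"
  shows "norm (hermitian_adjacency2 E A $ u $ v) = 1"
  using assms(2)
  by (rule mixed_graph_edge_cases[where A = A])
    (simp_all add: hermitian_adjacency2_simps[OF assms(1)] norm_omega)

lemma hermitian_laplacian2_mult_vec:
  assumes "mixed_graph E A"
  shows "(hermitian_laplacian2 E A *v x) $ u =
    (\<Sum>v | {u, v} \<in> E. x $ u - hermitian_adjacency2 E A $ u $ v * x $ v)"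
proof -
  have "(\<Sum>v\<in>UNIV. degree_matrix E $ u $ v * x $ v) = of_nat (vertex_degree E u) * x $ u"
    by (simp add: degree_matrix_def if_distrib[of "\<lambda>c. c * _"] cong: if_cong)
  also have "\<dots> = (\<Sum>v | {u, v} \<in> E. x $ u)"
    using assms by (simp add: vertex_degree_eq_card_neighbours mixed_graph_def)
  finally have D: "(\<Sum>v\<in>UNIV. degree_matrix E $ u $ v * x $ v) = (\<Sum>v | {u, v} \<in> E. x $ u)" .
  have N: "(\<Sum>v\<in>UNIV. hermitian_adjacency2 E A $ u $ v * x $ v) =
      (\<Sum>v | {u, v} \<in> E. hermitian_adjacency2 E A $ u $ v * x $ v)"
    by (rule sum.mono_neutral_right) (auto simp: hermitian_adjacency2_simps[OF assms])
  show ?thesis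
    by (simp add: hermitian_laplacian2_def matrix_vector_mult_def left_diff_distrib
        sum_subtractf D N)
qed

section \<open>Singularity and the equality case of averaging\<close>

lemma not_invertible_iff_kernel:
  fixes M :: "'a::field ^ 'n ^ 'n"
  shows "\<not> invertible M \<longleftrightarrow> (\<exists>x. x \<noteq> 0 \<and> M *v x = 0)"
  using matrix_left_invertible_ker[of M] by (auto simp: invertible_left_inverse)

text \<open>Expanding the square of \<open>norm (z - y v)\<close> and using \<open>le\<close> bounds
  it by twice the real part of \<open>cnj z * (z - y v)\<close>. These real parts are therefore
  nonnegative; they sum to 0, so each vanishes.\<close>

lemma sum_diff_zero_imp_eq:
  fixes z :: complex
  assumes "finite S" and "(\<Sum>v\<in>S. z - y v) = 0"
    and le: "\<And>v. v \<in> S \<Longrightarrow> norm (y v) \<le> norm z" and "v \<in> S"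
  shows "y v = z"
proof -
  have sq: "(norm (z - y v))\<^sup>2 \<le> 2 * Re (cnj z * (z - y v))" if "v \<in> S" for v
  proof -
    have "(norm (y v))\<^sup>2 \<le> (norm z)\<^sup>2"
      using le[OF that] by (intro power_mono) auto
    thus ?thesis
      by (simp add: cmod_power2) (simp add: power2_eq_square algebra_simps)
  qed
  have "(\<Sum>v\<in>S. Re (cnj z * (z - y v))) = Re (cnj z * (\<Sum>v\<in>S. z - y v))"
    by (simp only: sum_distrib_left Re_sum)
  hence "(\<Sum>v\<in>S. Re (cnj z * (z - y v))) = 0"
    using assms(2) by simp
  moreover have "0 \<le> Re (cnj z * (z - y v))" if "v \<in> S" for v
    using sq[OF that] zero_le_power2[of "norm (z - y v)"] by linarith
  ultimately have "Re (cnj z * (z - y v)) = 0"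
    using sum_nonneg_eq_0_iff[of S "\<lambda>v. Re (cnj z * (z - y v))"] assms(1,4) by blast
  hence "(norm (z - y v))\<^sup>2 \<le> 0"
    using sq[OF assms(4)] by simp
  thus ?thesis
    by simp
qed

section \<open>From a partition to a kernel vector\<close>

lemma property_SP_imp_kernel:
  assumes mg: "mixed_graph E A" and "property_SP E A"
  shows "\<exists>x. x \<noteq> 0 \<and> hermitian_laplacian2 E A *v x = 0"
proof -
  let ?c = "cnj omega"
  obtain V :: "nat \<Rightarrow> 'a set" where V: "(\<Union>i\<in>{1..6}. V i) = UNIV" "disjoint_family_on V {1..6}"
      and und: "\<And>u v. undirected_edge E A u v \<Longrightarrow> \<exists>i\<in>{1..6}. u \<in> V i \<and> v \<in> V i"
      and dir: "\<And>u v. (u, v) \<in> A \<Longrightarrow>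
        (\<exists>i\<in>{1..5}. u \<in> V i \<and> v \<in> V (i + 1)) \<or> (u \<in> V 6 \<and> v \<in> V 1)"
    using assms(2) unfolding property_SP_def by blast
  have "\<forall>u. \<exists>i. i \<in> {1..6} \<and> u \<in> V i"
    using V(1) by blast
  then obtain f where f: "\<And>u. f u \<in> {1..6} \<and> u \<in> V (f u)"
    by metis
  have f_eq: "f u = i" if "i \<in> {1..6}" "u \<in> V i" for u i
    using that f[of u] V(2) unfolding disjoint_family_on_def by blast
  \<comment> \<open>\<open>f u\<close> is the index of the part containing \<open>u\<close>, and
    \<open>?c\<close> is the inverse of \<open>omega\<close>.\<close>
  define x :: "complex ^ 'a" where "x = (\<chi> u. ?c ^ f u)"
  have und_x: "x $ u = x $ v" if uv: "undirected_edge E A u v" for u v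
  proof -
    obtain i where "i \<in> {1..6}" "u \<in> V i" "v \<in> V i"
      using und[OF uv] by blast
    thus ?thesis
      by (simp add: x_def f_eq)
  qed
  have dir_x: "x $ v = ?c * x $ u" if uv: "(u, v) \<in> A" for u v
    using dir[OF uv]
  proof
    assume "\<exists>i\<in>{1..5}. u \<in> V i \<and> v \<in> V (i + 1)"
    then obtain i where "i \<in> {1..5}" "u \<in> V i" "v \<in> V (i + 1)"
      by blast
    hence "f u = i" "f v = i + 1"
      by (auto intro: f_eq)
    thus ?thesis
      by (simp add: x_def)
  next
    \<comment> \<open>The wrap-around is consistent because \<open>?c ^ 6\<close> is 1.\<close>
    assume "u \<in> V 6 \<and> v \<in> V 1"
    hence "f u = 6" "f v = 1"
      by (auto intro: f_eq)
    thus ?thesis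
      by (simp add: x_def cnj_omega_powers)
  qed
  have "hermitian_adjacency2 E A $ u $ v * x $ v = x $ u" if "{u, v} \<in> E" for u v
    using that
  proof (cases rule: mixed_graph_edge_cases[where A = A])
    case 1
    thus ?thesis
      using und_x[OF 1] by (simp add: hermitian_adjacency2_simps[OF mg])
  next
    case 2
    thus ?thesis
      using dir_x[OF 2] omega_mult_cnj
      by (simp add: hermitian_adjacency2_simps[OF mg] mult.assoc[symmetric])
  next
    case 3
    thus ?thesis
      using dir_x[OF 3] by (simp add: hermitian_adjacency2_simps[OF mg])
  qed
  hence "hermitian_laplacian2 E A *v x = 0"
    by (simp add: vec_eq_iff hermitian_laplacian2_mult_vec[OF mg])
  moreover have "x \<noteq> 0"
    using omega_mult_cnj by (auto simp: vec_eq_iff x_def)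
  ultimately show ?thesis
    by blast
qed

section \<open>From a kernel vector to a partition\<close>

text \<open>A maximum principle for the modulus. That no entry vanishes later keeps the six
  candidate values distinct.\<close>

lemma kernel_constant_along_edges:
  assumes mg: "mixed_graph E A" and con: "connected_graph E"
    and "x \<noteq> 0" and ker: "hermitian_laplacian2 E A *v x = 0"
  shows "x $ u \<noteq> 0" and "{u, v} \<in> E \<Longrightarrow> hermitian_adjacency2 E A $ u $ v * x $ v = x $ u"
proof -
  define m where "m = Max (range (\<lambda>u. norm (x $ u)))"
  have le: "norm (x $ u) \<le> m" for u
    by (simp add: m_def)
  have "m \<in> range (\<lambda>u. norm (x $ u))"
    unfolding m_def by (intro Max_in) auto
  then obtain r where r: "norm (x $ r) = m"
    by auto
  have edge: "hermitian_adjacency2 E A $ u $ v * x $ v = x $ u"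
    if "norm (x $ u) = m" "{u, v} \<in> E" for u v
  proof (rule sum_diff_zero_imp_eq[where S = "{v. {u, v} \<in> E}"])
    show "(\<Sum>v | {u, v} \<in> E. x $ u - hermitian_adjacency2 E A $ u $ v * x $ v) = 0"
      using ker hermitian_laplacian2_mult_vec[OF mg, of x u] by simp
    show "norm (hermitian_adjacency2 E A $ u $ w * x $ w) \<le> norm (x $ u)"
      if "w \<in> {v. {u, v} \<in> E}" for w
      using that \<open>norm (x $ u) = m\<close> le[of w]
      by (simp add: norm_mult norm_hermitian_adjacency2[OF mg])
  qed (use that in auto)
  \<comment> \<open>The maximum spreads from \<open>r\<close> along paths, since the weights on
    edges have modulus 1.\<close>
  have max: "norm (x $ u) = m" for u
  proof -
    have "(r, u) \<in> (adj_rel E)\<^sup>*"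
      using con by (simp add: connected_graph_def)
    thus ?thesis
    proof (induction rule: rtrancl_induct)
      case base
      show ?case by (rule r)
    next
      case (step u v)
      hence uv: "{u, v} \<in> E"
        by (simp add: adj_rel_def)
      have "norm (x $ v) = norm (hermitian_adjacency2 E A $ u $ v * x $ v)"
        by (simp add: norm_mult norm_hermitian_adjacency2[OF mg uv])
      also have "\<dots> = m"
        using edge[OF step.IH uv] step.IH by simp
      finally show ?case .
    qed
  qed
  show "x $ u \<noteq> 0"
  proof
    assume "x $ u = 0"
    hence "m = 0"
      using max[of u] by simp
    hence "x = 0"
      using max by (simp add: vec_eq_iff)
    thus False
      using \<open>x \<noteq> 0\<close> by simp
  qed
  show "hermitian_adjacency2 E A $ u $ v * x $ v = x $ u" if "{u, v} \<in> E"
    using edge[OF max that] .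
qed

lemma kernel_imp_property_SP:
  assumes mg: "mixed_graph E A" and con: "connected_graph E"
    and x: "x \<noteq> 0" "hermitian_laplacian2 E A *v x = 0"
  shows "property_SP E A"
proof -
  let ?c = "cnj omega"
  note nz = kernel_constant_along_edges(1)[OF mg con x]
  note edge = kernel_constant_along_edges(2)[OF mg con x]
  have und: "x $ v = x $ u" if "undirected_edge E A u v" for u v
    using that edge[of u v] by (simp add: hermitian_adjacency2_simps[OF mg] undirected_edge_def)
  \<comment> \<open>Read at the head \<open>v\<close>, where the weight of the edge is
    \<open>cnj omega\<close>.\<close>
  have dir: "x $ v = ?c * x $ u" if "(u, v) \<in> A" for u v
    using that edge[of v u] mg
    by (simp add: hermitian_adjacency2_simps[OF mg] mixed_graph_def insert_commute)
  have dir': "x $ u = omega * x $ v" if "(u, v) \<in> A" for u v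
    using dir[OF that] omega_mult_cnj by (simp add: mult.assoc[symmetric])
  \<comment> \<open>An arbitrary base vertex, to whose entry all others are compared.\<close>
  define r :: 'a where "r = undefined"
  define V where "V i = {u. x $ u = ?c ^ i * x $ r}" for i :: nat
  have shift: "\<exists>j\<in>{1..6}. ?c * y = ?c ^ j * x $ r" if "i \<in> {1..6}" "y = ?c ^ i * x $ r" for i y
    using cnj_omega_power_shift[OF that(1)] that(2) by (metis mult.assoc)
  have cover: "\<exists>i\<in>{1..6}. u \<in> V i" for u
  proof -
    have "(r, u) \<in> (adj_rel E)\<^sup>*"
      using con by (simp add: connected_graph_def)
    thus ?thesis
    proof (induction rule: rtrancl_induct)
      case base
      \<comment> \<open>The base vertex lies in part 6, because exponent 0 is written as 6.\<close>
      show ?case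
        by (rule bexI[of _ 6]) (auto simp: V_def cnj_omega_powers)
    next
      case (step u v)
      then obtain i where i: "i \<in> {1..6}" "x $ u = ?c ^ i * x $ r"
        by (auto simp: V_def)
      have "{u, v} \<in> E"
        using step by (simp add: adj_rel_def)
      thus ?case
      proof (cases rule: mixed_graph_edge_cases[where A = A])
        case 1
        thus ?thesis
          using i und[OF 1] by (auto simp: V_def)
      next
        case 2
        thus ?thesis
          using shift[OF i] dir[OF 2] by (simp add: V_def)
      next
        case 3
        hence v: "x $ v = omega * ?c ^ i * x $ r"
          using dir'[of v u] i by simp
        \<comment> \<open>Going against an arrow lowers the exponent by one; from 1 it wraps to
          6.\<close>
        show ?thesis
        proof (cases "i = 1")
          case True
          thus ?thesis
            using v omega_mult_cnj by (intro bexI[of _ 6]) (auto simp: V_def cnj_omega_powers)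
        next
          case False
          then obtain j where "i = Suc j" "j \<in> {1..6}"
            using i(1) by (cases i) auto
          thus ?thesis
            using v omega_mult_cnj_power[of j] by (auto simp: V_def simp del: power_Suc)
        qed
      qed
    qed
  qed
  show ?thesis
    unfolding property_SP_def
  proof (intro exI[of _ V] conjI allI impI)
    show "(\<Union>i\<in>{1..6}. V i) = UNIV"
      using cover by blast
    \<comment> \<open>A common vertex of two parts gives two equal multiples of
      \<open>x $ r\<close>; cancelling this nonzero entry leaves equal powers of
      \<open>?c\<close>.\<close>
    show "disjoint_family_on V {1..6}"
      using inj_on_cnj_omega_power nz[of r]
      by (auto simp: disjoint_family_on_def V_def inj_on_def)
  next
    fix u v assume uv: "undirected_edge E A u v"
    thus "\<exists>i\<in>{1..6}. u \<in> V i \<and> v \<in> V i"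
      using cover[of u] und[OF uv] by (auto simp: V_def)
  next
    fix u v assume uv: "(u, v) \<in> A"
    obtain i where i: "i \<in> {1..6}" "u \<in> V i"
      using cover by blast
    show "(\<exists>i\<in>{1..5}. u \<in> V i \<and> v \<in> V (i + 1)) \<or> (u \<in> V 6 \<and> v \<in> V 1)"
    proof (cases "i = 6")
      case True
      thus ?thesis
        using i dir[OF uv] by (simp add: V_def cnj_omega_powers)
    next
      case False
      thus ?thesis
        using i dir[OF uv] by (intro disjI1 bexI[of _ i]) (auto simp: V_def)
    qed
  qed
qed

theorem theorem2p11:
  fixes E :: "'v::finite set set" and A :: "('v \<times> 'v) set"
  assumes "mixed_graph E A" and "connected_graph E"
  shows "property_SP E A \<longleftrightarrow> \<not> invertible (hermitian_laplacian2 E A)"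
  unfolding not_invertible_iff_kernel
  using property_SP_imp_kernel[OF assms(1)] kernel_imp_property_SP[OF assms] by blast

end
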